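(* Let $X$ be a compact metric space with Borel $\sigma$-algebra $\mathcal{B}$, let $m$ be a probability measure on $(X,\mathcal{B})$ (a reference measure, not assumed to be invariant), and let $Q(\cdot,\cdot)$ be the one-step transition probabilities of a homogeneous discrete-time Markov chain on $(X,\mathcal{B})$. Then: \begin{itemize} \item[(0)] $\mathrm{Rec}(Q)\supseteq \mathrm{Rec}_u(Q)$, $\mathrm{Rec}_u(Q)\subseteq \mathrm{Rec}_{wu}(Q)\subseteq \mathrm{Rec}_w(Q)$, and $\mathrm{Rec}_w(Q)\supseteq \mathrm{Clos}(\mathrm{Rec}(Q))$. \item[(a)] If $\sum_{n\ge 1} m(Q^{-n}(A)\cap A)=\infty$ for every $A\in\mathcal{B}$ with $m(A)>0$, then $m(\mathrm{Rec}(Q))=1$ and $\mathrm{Rec}_w(Q)\supseteq \mathrm{supp}(m)$. \item[(b)] $\mathrm{Rec}_w(Q)\neq\emptyset$. \item[(c)] If $\mu$ is a probability measure on $(X,\mathcal{B})$ that is invariant for the Markov chain with transition probabilities $Q(\cdot,\cdot)$, then $\mu(\mathrm{Rec}(Q))=1$. \end{itemize}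
   Context: Transition probabilities $Q(x,A)=P(\xi_{t+1}\in A\mid \xi_t=x)$ form a Markov kernel on $(X,\mathcal{B})$: a probability measure in $A$ for each $x$, measurable in $x$ for each $A\in\mathcal{B}$. For $n\ge 1$, $Q^n(x,A)=P(\xi_{t+n}\in A\mid\xi_t=x)$ denotes the $n$-step transition probabilities, so $Q^1=Q$ and $Q^{n+1}(x,A)=\int Q^n(y,A)\,Q(x,dy)$. The chain acts on measures by $Q\mu(A)=\int Q(x,A)\,d\mu(x)$, and $\mu$ is invariant if $Q\mu=\mu$. For $B\in\mathcal{B}$ and $n\ge1$ put $Q^{-n}(B):=\{x\in X: Q^n(x,B)>0\}$. $\mathrm{Clos}$ denotes topological closure and $\mathrm{supp}(m)$ the topological support of $m$. A point $x\in X$ is called: \begin{itemize} \item recurrent, if for every open neighborhood $O_x\ni x$ there is an integer $t\ge1$ with $Q^t(x,O_x)>0$; \item weakly recurrent, if for every open neighborhood $O_x\ni x$ there are $y\in O_x$ and an integer $t\ge 1$ with $Q^t(y,O_x)>0$; \item uniformly recurrent, if $\liminf_{n\to\infty}Q^n(x,O_x)>0$ for every open neighborhood $O_x\ni x$; \item uniformly weakly recurrent, if for every open neighborhood $O_x\ni x$ there is $y\in O_x$ with $\liminf_{n\to\infty}Q^n(y,O_x)>0$. \end{itemize} The sets of recurrent, weakly recurrent, uniformly recurrent and uniformly weakly recurrent points are denoted $\mathrm{Rec}(Q)$, $\mathrm{Rec}_w(Q)$, $\mathrm{Rec}_u(Q)$ and $\mathrm{Rec}_{wu}(Q)$ respectively.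 *)

theory Defs
  imports "HOL-Probability.Probability"
begin

text \<open>
  A Markov kernel on a metric space is a measurable map into the Giry space of Borel probability
  measures, \<open>Q \<in> borel \<rightarrow>\<^sub>M prob_algebra borel\<close>; the number \<open>Q(x, A)\<close> is \<open>emeasure (Q x) A\<close>.
\<close>

lemma markov_kernel_iff:
  fixes Q :: "'a::metric_space \<Rightarrow> 'a measure"
  shows "Q \<in> borel \<rightarrow>\<^sub>M prob_algebra borel \<longleftrightarrow>
    (\<forall>x. prob_space (Q x) \<and> sets (Q x) = sets borel) \<and>
    (\<forall>A\<in>sets borel. (\<lambda>x. emeasure (Q x) A) \<in> borel_measurable borel)"
proof
  assume Q: "Q \<in> borel \<rightarrow>\<^sub>M prob_algebra borel"
  have "Q x \<in> space (prob_algebra borel)" for x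
    using measurable_space[OF Q, of x] by simp
  moreover have "(\<lambda>x. emeasure (Q x) A) \<in> borel_measurable borel" if "A \<in> sets borel" for A
    using measurable_emeasure_kernel[OF measurable_prob_algebraD[OF Q] that] .
  ultimately show "(\<forall>x. prob_space (Q x) \<and> sets (Q x) = sets borel) \<and>
    (\<forall>A\<in>sets borel. (\<lambda>x. emeasure (Q x) A) \<in> borel_measurable borel)"
    by (auto simp: space_prob_algebra)
next
  assume "(\<forall>x. prob_space (Q x) \<and> sets (Q x) = sets borel) \<and>
    (\<forall>A\<in>sets borel. (\<lambda>x. emeasure (Q x) A) \<in> borel_measurable borel)"
  then show "Q \<in> borel \<rightarrow>\<^sub>M prob_algebra borel"
    by (intro measurable_prob_algebraI measurable_subprob_algebra)
       (auto intro: prob_space_imp_subprob_space)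
qed

text \<open>
  The monadic bind satisfies \<open>(\<mu> \<bind> Q)(A) = \<integral> Q(x, A) d\<mu>(x)\<close>.  The \<open>0\<close>-step kernel is the Dirac
  kernel, so that one step gives back \<open>Q\<close>; see the lemmas below.
\<close>

primrec kernel_pow :: "('a::metric_space \<Rightarrow> 'a measure) \<Rightarrow> nat \<Rightarrow> 'a \<Rightarrow> 'a measure" where
  "kernel_pow Q 0 = return borel"
| "kernel_pow Q (Suc n) = (\<lambda>x. Q x \<bind> kernel_pow Q n)"

definition invariant_measure ::
    "('a::metric_space \<Rightarrow> 'a measure) \<Rightarrow> 'a measure \<Rightarrow> bool" where
  "invariant_measure Q \<mu> \<longleftrightarrow> \<mu> \<bind> Q = \<mu>"

lemma kernel_pow_measurable:
  assumes Q: "Q \<in> borel \<rightarrow>\<^sub>M prob_algebra borel"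
  shows "kernel_pow Q n \<in> borel \<rightarrow>\<^sub>M prob_algebra borel"
proof (induction n)
  case 0
  show ?case by simp
next
  case (Suc n)
  show ?case using Q Suc by simp
qed

lemma kernel_pow_1:
  assumes Q: "Q \<in> borel \<rightarrow>\<^sub>M prob_algebra borel"
  shows "kernel_pow Q 1 x = Q x"
proof -
  have "sets (Q x) = sets borel" using Q by (simp add: markov_kernel_iff)
  then show ?thesis by (simp add: bind_return'')
qed

lemma emeasure_kernel_pow_Suc:
  assumes Q: "Q \<in> borel \<rightarrow>\<^sub>M prob_algebra borel" and A: "A \<in> sets borel"
  shows "emeasure (kernel_pow Q (Suc n) x) A = (\<integral>\<^sup>+ y. emeasure (kernel_pow Q n y) A \<partial>Q x)"
proof -
  have s: "sets (Q x) = sets borel" using Q by (simp add: markov_kernel_iff)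
  then have "space (Q x) \<noteq> {}" using sets_eq_imp_space_eq[OF s] by simp
  moreover have "kernel_pow Q n \<in> Q x \<rightarrow>\<^sub>M subprob_algebra borel"
    using measurable_prob_algebraD[OF kernel_pow_measurable[OF Q]]
    by (simp add: measurable_cong_sets[OF s refl])
  ultimately show ?thesis using A by (simp add: emeasure_bind)
qed

lemma invariant_measure_iff:
  assumes Q: "Q \<in> borel \<rightarrow>\<^sub>M prob_algebra borel" and s: "sets \<mu> = sets borel"
  shows "invariant_measure Q \<mu> \<longleftrightarrow>
    (\<forall>A\<in>sets borel. (\<integral>\<^sup>+ x. emeasure (Q x) A \<partial>\<mu>) = emeasure \<mu> A)"
proof -
  have ne: "space \<mu> \<noteq> {}" using sets_eq_imp_space_eq[OF s] by simp
  have K: "Q \<in> \<mu> \<rightarrow>\<^sub>M subprob_algebra borel"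
    using measurable_prob_algebraD[OF Q] by (simp add: measurable_cong_sets[OF s refl])
  have e: "emeasure (\<mu> \<bind> Q) A = (\<integral>\<^sup>+ x. emeasure (Q x) A \<partial>\<mu>)" if "A \<in> sets borel" for A
    using emeasure_bind[OF ne K that] .
  have "sets (\<mu> \<bind> Q) = sets borel"
    using ne Q by (intro sets_bind) (simp_all add: markov_kernel_iff)
  then show ?thesis
    unfolding invariant_measure_def using e s by (metis measure_eqI)
qed

definition kernel_preimage ::
    "('a::metric_space \<Rightarrow> 'a measure) \<Rightarrow> nat \<Rightarrow> 'a set \<Rightarrow> 'a set" where
  "kernel_preimage Q n B = {x. emeasure (kernel_pow Q n x) B > 0}"

definition Rec :: "('a::metric_space \<Rightarrow> 'a measure) \<Rightarrow> 'a set" where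
  "Rec Q = {x. \<forall>U. open U \<and> x \<in> U \<longrightarrow> (\<exists>t\<ge>1. emeasure (kernel_pow Q t x) U > 0)}"

definition Rec_w :: "('a::metric_space \<Rightarrow> 'a measure) \<Rightarrow> 'a set" where
  "Rec_w Q = {x. \<forall>U. open U \<and> x \<in> U \<longrightarrow>
     (\<exists>y\<in>U. \<exists>t\<ge>1. emeasure (kernel_pow Q t y) U > 0)}"

definition Rec_u :: "('a::metric_space \<Rightarrow> 'a measure) \<Rightarrow> 'a set" where
  "Rec_u Q = {x. \<forall>U. open U \<and> x \<in> U \<longrightarrow> liminf (\<lambda>n. emeasure (kernel_pow Q n x) U) > 0}"

definition Rec_wu :: "('a::metric_space \<Rightarrow> 'a measure) \<Rightarrow> 'a set" where
  "Rec_wu Q = {x. \<forall>U. open U \<and> x \<in> U \<longrightarrow>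
     (\<exists>y\<in>U. liminf (\<lambda>n. emeasure (kernel_pow Q n y) U) > 0)}"

definition supp :: "'a::topological_space measure \<Rightarrow> 'a set" where
  "supp m = {x. \<forall>U. open U \<and> x \<in> U \<longrightarrow> emeasure m U > 0}"

end

theory Submission
  imports Defs
begin

text \<open>
  Parts (a), (b) and (c) are about one kind of set: call \<open>D\<close> non-returning if the chain started in \<open>D\<close>
  has probability zero of being in \<open>D\<close> at any given later time.  A point fails to be weakly
  recurrent exactly when it has a non-returning open neighborhood; and the points that fail to be
  recurrent are covered by countably many non-returning Borel sets, because the topology has a
  countable base \<open>B\<^sub>1, B\<^sub>2, \<dots>\<close> and the points of \<open>B\<^sub>k\<close> from which \<open>B\<^sub>k\<close> is never revisited form
  a non-returning set.  Hence a probability measure that annihilates non-returning Borel sets is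
  carried by the recurrent points (\<open>emeasure_Rec_eq_1\<close>).

  For the measure \<open>m\<close> in part (a) this annihilation is immediate: if \<open>D\<close> is non-returning, every
  set \<open>Q\<^sup>-\<^sup>n(D) \<inter> D\<close> is empty, and the series of their measures cannot diverge.  A set of full
  measure is dense in the support, so the support lies in \<open>closure (Rec Q)\<close>.  Parts (b) and (c)
  rest on the fact that the expected number of visits to a non-returning set is at most \<open>1\<close> from
  any starting point (\<open>expected_visits_le_1\<close>): after the first visit there is no other.

  For an invariant \<open>\<mu>\<close>, the expected number of visits to \<open>D\<close> before time \<open>n\<close> is \<open>n \<mu>(D)\<close>, so
  \<open>n \<mu>(D) \<le> 1\<close> for all \<open>n\<close> and \<open>\<mu>(D) = 0\<close>.  If no point were weakly recurrent, compactness would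
  cover the space by \<open>N\<close> non-returning open sets; the \<open>N + 1\<close> visits to the whole space
  before time \<open>N + 1\<close> would then have to be shared among sets that receive at most one each on
  average.
\<close>

section \<open>Non-returning sets\<close>

definition non_returning :: "('a::metric_space \<Rightarrow> 'a measure) \<Rightarrow> 'a set \<Rightarrow> bool" where
  "non_returning Q D \<longleftrightarrow> (\<forall>x\<in>D. \<forall>t\<ge>1. emeasure (kernel_pow Q t x) D = 0)"

lemma not_in_Rec_w_iff:
  "x \<notin> Rec_w Q \<longleftrightarrow> (\<exists>U. open U \<and> x \<in> U \<and> non_returning Q U)"
  unfolding Rec_w_def non_returning_def by (auto simp: zero_less_iff_neq_zero)

lemma kernel_preimage_Int_non_returning:
  assumes "non_returning Q D"
  shows "kernel_preimage Q (Suc n) D \<inter> D = {}"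
  using assms by (auto simp: kernel_preimage_def non_returning_def simp del: kernel_pow.simps)

lemma sets_kernel_pow:
  assumes "Q \<in> borel \<rightarrow>\<^sub>M prob_algebra borel"
  shows "sets (kernel_pow Q n x) = sets borel"
  using kernel_pow_measurable[OF assms] by (simp add: markov_kernel_iff)

lemma prob_space_kernel_pow:
  assumes "Q \<in> borel \<rightarrow>\<^sub>M prob_algebra borel"
  shows "prob_space (kernel_pow Q n x)"
  using kernel_pow_measurable[OF assms] by (simp add: markov_kernel_iff)

lemma borel_measurable_emeasure_kernel_pow:
  assumes "Q \<in> borel \<rightarrow>\<^sub>M prob_algebra borel" and "A \<in> sets borel"
  shows "(\<lambda>x. emeasure (kernel_pow Q n x) A) \<in> borel_measurable borel"
  using kernel_pow_measurable[OF assms(1)] assms(2) by (simp add: markov_kernel_iff)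

text \<open>
  Condition on the first step.  From a point of \<open>D\<close> the visit at time \<open>0\<close> is the only one; from
  any other point the count is the average, over the position after one step, of a count with a
  horizon shorter by one.
\<close>

lemma expected_visits_le_1:
  assumes Q: "Q \<in> borel \<rightarrow>\<^sub>M prob_algebra borel"
    and D: "D \<in> sets borel" "non_returning Q D"
  shows "(\<Sum>k<n. emeasure (kernel_pow Q k x) D) \<le> 1"
proof (induction n arbitrary: x)
  case 0
  show ?case by simp
next
  case (Suc n)
  have split: "(\<Sum>k<Suc n. emeasure (kernel_pow Q k x) D) =
      indicator D x + (\<Sum>k<n. emeasure (kernel_pow Q (Suc k) x) D)"
    using D(1) by (simp add: sum.lessThan_Suc_shift del: kernel_pow.simps(2) sum.lessThan_Suc)
  show ?case
  proof (cases "x \<in> D")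
    case True
    then have "emeasure (kernel_pow Q (Suc k) x) D = 0" for k
      using D(2) by (simp add: non_returning_def del: kernel_pow.simps)
    with True show ?thesis
      unfolding split by (simp del: kernel_pow.simps)
  next
    case False
    have Qx: "prob_space (Q x)" "sets (Q x) = sets borel"
      using Q by (simp_all add: markov_kernel_iff)
    have meas: "(\<lambda>y. emeasure (kernel_pow Q k y) D) \<in> borel_measurable (Q x)" for k
      using borel_measurable_emeasure_kernel_pow[OF Q D(1)]
      by (simp add: measurable_cong_sets[OF Qx(2) refl])
    have "(\<Sum>k<n. emeasure (kernel_pow Q (Suc k) x) D) =
        (\<integral>\<^sup>+ y. (\<Sum>k<n. emeasure (kernel_pow Q k y) D) \<partial>Q x)"
      unfolding emeasure_kernel_pow_Suc[OF Q D(1)] by (simp add: nn_integral_sum meas)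
    also have "\<dots> \<le> (\<integral>\<^sup>+ y. 1 \<partial>Q x)"
      by (intro nn_integral_mono Suc.IH)
    also have "\<dots> = 1"
      using prob_space.emeasure_space_1[OF Qx(1)] by simp
    finally show ?thesis
      unfolding split using False by simp
  qed
qed

section \<open>Recurrence almost everywhere\<close>

text \<open>
  Second countability comes from total boundedness: for each \<open>n\<close>, finitely many balls of radius
  \<open>1 / (n + 1)\<close> cover the space, and all these balls together form a base.
\<close>

lemma compact_UNIV_countable_base:
  assumes "compact (UNIV :: 'a set)"
  obtains \<B> :: "'a::metric_space set set" where "countable \<B>" "\<And>B. B \<in> \<B> \<Longrightarrow> open B"
    "\<And>U x. open U \<Longrightarrow> x \<in> U \<Longrightarrow> \<exists>B\<in>\<B>. x \<in> B \<and> B \<subseteq> U"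
proof -
  have "\<exists>F :: 'a set. finite F \<and> UNIV \<subseteq> (\<Union>c\<in>F. ball c (1 / real (Suc n)))" for n
    using assms unfolding compact_eq_totally_bounded
    by (metis of_nat_0_less_iff zero_less_Suc zero_less_divide_1_iff)
  then obtain F :: "nat \<Rightarrow> 'a set" where F: "\<And>n. finite (F n)"
    "\<And>n. UNIV \<subseteq> (\<Union>c\<in>F n. ball c (1 / real (Suc n)))"
    by metis
  define \<B> where "\<B> = (\<Union>n. (\<lambda>c. ball c (1 / real (Suc n))) ` F n)"
  show thesis
  proof
    show "countable \<B>"
      unfolding \<B>_def
      by (intro countable_UN countable_image countableI_type) (simp add: countable_finite F(1))
    show "open B" if "B \<in> \<B>" for B
      using that by (auto simp: \<B>_def)
    fix U and x :: 'a assume "open U" "x \<in> U"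
    then obtain e where e: "e > 0" "ball x e \<subseteq> U"
      by (auto simp: open_contains_ball)
    \<comment> \<open>A ball of radius less than \<open>e / 2\<close> that contains \<open>x\<close> lies inside \<open>ball x e\<close>.\<close>
    obtain n where n: "1 / real (Suc n) < e / 2"
      using e(1) by (metis half_gt_zero inverse_eq_divide reals_Archimedean)
    obtain c where c: "c \<in> F n" "x \<in> ball c (1 / real (Suc n))"
      using F(2)[of n] by blast
    have "ball c (1 / real (Suc n)) \<subseteq> ball x e"
    proof
      fix y assume "y \<in> ball c (1 / real (Suc n))"
      then have "dist c y < e / 2" "dist c x < e / 2"
        using c(2) n by auto
      then show "y \<in> ball x e"
        using dist_triangle[of x y c] by (simp add: dist_commute)
    qed
    with c e(2) show "\<exists>B\<in>\<B>. x \<in> B \<and> B \<subseteq> U"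
      by (intro bexI[of _ "ball c (1 / real (Suc n))"]) (auto simp: \<B>_def)
  qed
qed

lemma emeasure_Rec_eq_1:
  fixes Q :: "'a::metric_space \<Rightarrow> 'a measure"
  assumes cpt: "compact (UNIV :: 'a set)"
    and Q: "Q \<in> borel \<rightarrow>\<^sub>M prob_algebra borel"
    and M: "prob_space M" "sets M = sets borel"
    and null: "\<And>D. D \<in> sets borel \<Longrightarrow> non_returning Q D \<Longrightarrow> emeasure M D = 0"
  shows "emeasure M (Rec Q) = 1"
proof -
  obtain \<B> :: "'a set set" where \<B>: "countable \<B>" "\<And>B. B \<in> \<B> \<Longrightarrow> open B"
    "\<And>U x. open U \<Longrightarrow> x \<in> U \<Longrightarrow> \<exists>B\<in>\<B>. x \<in> B \<and> B \<subseteq> U"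
    using compact_UNIV_countable_base[OF cpt] by blast
  define D where "D B = B \<inter> (\<Inter>t. {x. emeasure (kernel_pow Q (Suc t) x) B = 0})" for B
  have "D B \<in> null_sets M" if "B \<in> \<B>" for B
  proof -
    have B: "B \<in> sets borel"
      using \<B>(2)[OF that] by simp
    have "{x. emeasure (kernel_pow Q t x) B = 0} \<in> sets borel" for t
      using borel_measurable_emeasure_kernel_pow[OF Q B, of t] by measurable
    then have DB: "D B \<in> sets borel"
      unfolding D_def using B by (intro sets.Int sets.countable_INT) (auto simp del: kernel_pow.simps)
    \<comment> \<open>\<open>D B\<close> is a part of \<open>B\<close>, so a chain that misses \<open>B\<close> misses \<open>D B\<close> too.\<close>
    have "emeasure (kernel_pow Q t x) (D B) = 0" if "x \<in> D B" "t \<ge> 1" for x t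
    proof -
      obtain s where s: "t = Suc s"
        using \<open>t \<ge> 1\<close> by (cases t) auto
      have "emeasure (kernel_pow Q t x) (D B) \<le> emeasure (kernel_pow Q t x) B"
        using B by (intro emeasure_mono) (auto simp: D_def sets_kernel_pow[OF Q])
      also have "\<dots> = 0"
        using \<open>x \<in> D B\<close> unfolding D_def s by blast
      finally show ?thesis by simp
    qed
    then have "non_returning Q (D B)"
      by (auto simp: non_returning_def)
    then show ?thesis
      using null[OF DB] DB M(2) by (simp add: null_sets_def)
  qed
  then have N: "(\<Union>B\<in>\<B>. D B) \<in> null_sets M"
    using \<B>(1) by (intro null_sets_UN')
  have "- Rec Q = (\<Union>B\<in>\<B>. D B)"
  proof (intro equalityI subsetI)
    fix x assume "x \<in> - Rec Q"
    then obtain U where U: "open U" "x \<in> U" "\<And>t. t \<ge> 1 \<Longrightarrow> emeasure (kernel_pow Q t x) U = 0"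
      by (auto simp: Rec_def zero_less_iff_neq_zero)
    obtain B where B: "B \<in> \<B>" "x \<in> B" "B \<subseteq> U"
      using \<B>(3)[OF U(1,2)] by blast
    have "emeasure (kernel_pow Q (Suc t) x) B \<le> emeasure (kernel_pow Q (Suc t) x) U" for t
      using U(1) B(3) by (intro emeasure_mono)
        (simp_all add: sets_kernel_pow[OF Q] del: kernel_pow.simps)
    then have "x \<in> D B"
      using B(2) U(3) by (auto simp: D_def simp del: kernel_pow.simps)
    with B(1) show "x \<in> (\<Union>B\<in>\<B>. D B)" by blast
  next
    fix x assume "x \<in> (\<Union>B\<in>\<B>. D B)"
    then obtain B where B: "B \<in> \<B>" "x \<in> B"
      "\<And>t. emeasure (kernel_pow Q (Suc t) x) B = 0"
      by (auto simp: D_def simp del: kernel_pow.simps)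
    have "\<not> emeasure (kernel_pow Q t x) B > 0" if "t \<ge> 1" for t
      using B(3)[of "t - 1"] that by (simp del: kernel_pow.simps)
    then show "x \<in> - Rec Q"
      using B(2) \<B>(2)[OF B(1)] unfolding Rec_def by blast
  qed
  with N have "- Rec Q \<in> null_sets M" by simp
  moreover have "space M = UNIV"
    using sets_eq_imp_space_eq[OF M(2)] by simp
  ultimately have "emeasure M (space M - (- Rec Q)) = emeasure M (space M)"
    by (intro emeasure_Diff_null_set) (auto simp: M(2))
  with \<open>space M = UNIV\<close> show ?thesis
    using prob_space.emeasure_space_1[OF M(1)] by (simp add: Diff_eq)
qed

section \<open>Invariant measures\<close>

lemma nn_integral_emeasure_kernel_pow:
  assumes Q: "Q \<in> borel \<rightarrow>\<^sub>M prob_algebra borel"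
    and \<mu>: "sets \<mu> = sets borel" "invariant_measure Q \<mu>"
    and A: "A \<in> sets borel"
  shows "(\<integral>\<^sup>+ x. emeasure (kernel_pow Q n x) A \<partial>\<mu>) = emeasure \<mu> A"
proof (induction n)
  case 0
  have "A \<in> sets \<mu>" using A \<mu>(1) by simp
  then show ?case using A by simp
next
  case (Suc n)
  have K: "Q \<in> \<mu> \<rightarrow>\<^sub>M subprob_algebra borel"
    using measurable_prob_algebraD[OF Q] by (simp add: measurable_cong_sets[OF \<mu>(1) refl])
  have "(\<integral>\<^sup>+ x. emeasure (kernel_pow Q (Suc n) x) A \<partial>\<mu>) =
      (\<integral>\<^sup>+ x. (\<integral>\<^sup>+ y. emeasure (kernel_pow Q n y) A \<partial>Q x) \<partial>\<mu>)"
    unfolding emeasure_kernel_pow_Suc[OF Q A] ..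
  also have "\<dots> = (\<integral>\<^sup>+ y. emeasure (kernel_pow Q n y) A \<partial>(\<mu> \<bind> Q))"
    using nn_integral_bind[OF borel_measurable_emeasure_kernel_pow[OF Q A] K] by simp
  also have "\<dots> = emeasure \<mu> A"
    using \<mu>(2) Suc.IH by (simp add: invariant_measure_def)
  finally show ?case .
qed

text \<open>
  An invariant measure starts a stationary chain, whose expected number of visits to \<open>D\<close> grows
  linearly in time at rate \<open>\<mu>(D)\<close>; for a non-returning set it stays bounded.
\<close>

lemma invariant_measure_non_returning:
  assumes Q: "Q \<in> borel \<rightarrow>\<^sub>M prob_algebra borel"
    and \<mu>: "prob_space \<mu>" "sets \<mu> = sets borel" "invariant_measure Q \<mu>"
    and D: "D \<in> sets borel" "non_returning Q D"
  shows "emeasure \<mu> D = 0"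
proof -
  interpret prob_space \<mu> by fact
  have meas: "(\<lambda>y. emeasure (kernel_pow Q k y) D) \<in> borel_measurable \<mu>" for k
    using borel_measurable_emeasure_kernel_pow[OF Q D(1)]
    by (simp add: measurable_cong_sets[OF \<mu>(2) refl])
  have bound: "of_nat n * emeasure \<mu> D \<le> 1" for n
  proof -
    have "of_nat n * emeasure \<mu> D = (\<Sum>k<n. \<integral>\<^sup>+ x. emeasure (kernel_pow Q k x) D \<partial>\<mu>)"
      by (simp add: nn_integral_emeasure_kernel_pow[OF Q \<mu>(2,3) D(1)])
    also have "\<dots> = (\<integral>\<^sup>+ x. (\<Sum>k<n. emeasure (kernel_pow Q k x) D) \<partial>\<mu>)"
      by (simp add: nn_integral_sum meas)
    also have "\<dots> \<le> (\<integral>\<^sup>+ x. 1 \<partial>\<mu>)"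
      by (intro nn_integral_mono expected_visits_le_1[OF Q D])
    also have "\<dots> = 1"
      by (simp add: emeasure_space_1)
    finally show ?thesis .
  qed
  have "real n * measure \<mu> D \<le> 1" for n
    using bound[of n]
    by (simp add: emeasure_eq_measure ennreal_of_nat_eq_real_of_nat flip: ennreal_mult')
  then have "\<not> measure \<mu> D > 0"
    by (meson ex_less_of_nat_mult not_less)
  then have "measure \<mu> D = 0"
    using measure_nonneg[of \<mu> D] by linarith
  then show ?thesis
    by (simp add: emeasure_eq_measure)
qed

section \<open>Existence of weakly recurrent points\<close>

lemma Rec_w_nonempty:
  fixes Q :: "'a::metric_space \<Rightarrow> 'a measure"
  assumes cpt: "compact (UNIV :: 'a set)"
    and Q: "Q \<in> borel \<rightarrow>\<^sub>M prob_algebra borel"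
  shows "Rec_w Q \<noteq> {}"
proof
  assume "Rec_w Q = {}"
  then have "UNIV \<subseteq> \<Union>{U. open U \<and> non_returning Q U}"
    using not_in_Rec_w_iff[of _ Q] by blast
  then obtain C where C: "finite C" "C \<subseteq> {U. open U \<and> non_returning Q U}" "UNIV \<subseteq> \<Union>C"
    using compactE[OF cpt] by (metis (mono_tags, lifting) mem_Collect_eq)
  \<comment> \<open>The starting point is arbitrary; more than \<open>card C\<close> time steps give the contradiction.\<close>
  fix x :: 'a
  have mass: "1 \<le> (\<Sum>U\<in>C. emeasure (kernel_pow Q k x) U)" for k
  proof -
    have "space (kernel_pow Q k x) = UNIV"
      using sets_eq_imp_space_eq[OF sets_kernel_pow[OF Q]] by simp
    with C(3) have "1 = emeasure (kernel_pow Q k x) (\<Union>U\<in>C. U)"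
      using prob_space.emeasure_space_1[OF prob_space_kernel_pow[OF Q, of k x]]
      by (simp add: top.extremum_unique)
    also have "\<dots> \<le> (\<Sum>U\<in>C. emeasure (kernel_pow Q k x) U)"
      using C(1,2) by (intro emeasure_subadditive_finite) (auto simp: sets_kernel_pow[OF Q])
    finally show ?thesis .
  qed
  have "of_nat (Suc (card C)) = (\<Sum>k<Suc (card C). 1 :: ennreal)"
    by simp
  also have "\<dots> \<le> (\<Sum>k<Suc (card C). \<Sum>U\<in>C. emeasure (kernel_pow Q k x) U)"
    by (intro sum_mono mass)
  also have "\<dots> = (\<Sum>U\<in>C. \<Sum>k<Suc (card C). emeasure (kernel_pow Q k x) U)"
    by (rule sum.swap)
  also have "\<dots> \<le> (\<Sum>U\<in>C. 1)"
    using C(2) by (intro sum_mono expected_visits_le_1[OF Q]) auto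
  also have "\<dots> = of_nat (card C)"
    by simp
  finally have "(of_nat (Suc (card C)) :: ennreal) \<le> of_nat (card C)" .
  then show False
    unfolding of_nat_le_iff by simp
qed

section \<open>The recurrence theorem\<close>

lemma liminf_pos_imp_ex_pos:
  fixes f :: "nat \<Rightarrow> ennreal"
  assumes "liminf f > 0"
  shows "\<exists>t\<ge>1. f t > 0"
proof -
  have "eventually (\<lambda>t. f t > 0) sequentially"
    using assms by (rule less_LiminfD)
  then obtain N where "\<And>t. t \<ge> N \<Longrightarrow> f t > 0"
    by (auto simp: eventually_sequentially)
  then show ?thesis
    by (intro exI[of _ "max 1 N"]) auto
qed

lemma closure_Rec_subset_Rec_w: "closure (Rec Q) \<subseteq> Rec_w Q"
proof
  fix x assume x: "x \<in> closure (Rec Q)"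
  show "x \<in> Rec_w Q"
    unfolding Rec_w_def
  proof (intro CollectI allI impI)
    fix U assume U: "open U \<and> x \<in> U"
    with x obtain y where "y \<in> Rec Q" "y \<in> U"
      using open_Int_closure_eq_empty[of U "Rec Q"] by blast
    with U show "\<exists>y\<in>U. \<exists>t\<ge>1. emeasure (kernel_pow Q t y) U > 0"
      unfolding Rec_def by blast
  qed
qed

lemma supp_subset_Rec_w:
  fixes Q :: "'a::metric_space \<Rightarrow> 'a measure"
  assumes M: "prob_space M" "sets M = sets borel"
    and full: "emeasure M (Rec Q) = 1"
  shows "supp M \<subseteq> Rec_w Q"
proof -
  interpret prob_space M by fact
  have "x \<in> closure (Rec Q)" if x: "x \<in> supp M" for x
  proof (rule ccontr)
    assume "x \<notin> closure (Rec Q)"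
    moreover have "open (- closure (Rec Q))"
      by (intro open_Compl closed_closure)
    ultimately have "emeasure M (- closure (Rec Q)) > 0"
      using x unfolding supp_def by blast
    have space: "space M = UNIV"
      using sets_eq_imp_space_eq[OF M(2)] by simp
    have "emeasure M (Rec Q) \<le> emeasure M (closure (Rec Q))"
      using M(2) by (intro emeasure_mono closure_subset) simp
    then have "emeasure M (closure (Rec Q)) = 1"
      using full emeasure_le_1 by (metis antisym)
    then have "emeasure M (- closure (Rec Q)) = 0"
      using emeasure_compl[of "closure (Rec Q)" M] M(2) emeasure_space_1
      by (simp add: space Compl_eq_Diff_UNIV)
    with \<open>emeasure M (- closure (Rec Q)) > 0\<close> show False by simp
  qed
  then show ?thesis
    using closure_Rec_subset_Rec_w by blast
qed

theorem theorem2: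
  fixes Q :: "'a::metric_space \<Rightarrow> 'a measure" and m :: "'a measure"
  assumes "compact (UNIV :: 'a set)"
    and "prob_space m" and "sets m = sets borel"
    and "Q \<in> borel \<rightarrow>\<^sub>M prob_algebra borel"
  shows "(Rec_u Q \<subseteq> Rec Q \<and> Rec_u Q \<subseteq> Rec_wu Q \<and> Rec_wu Q \<subseteq> Rec_w Q \<and>
          closure (Rec Q) \<subseteq> Rec_w Q)
    \<and> ((\<forall>A\<in>sets borel. emeasure m A > 0 \<longrightarrow>
          (\<Sum>n. emeasure m (kernel_preimage Q (Suc n) A \<inter> A)) = \<infinity>)
        \<longrightarrow> emeasure m (Rec Q) = 1 \<and> supp m \<subseteq> Rec_w Q)
    \<and> Rec_w Q \<noteq> {}
    \<and> (\<forall>\<mu> :: 'a measure. prob_space \<mu> \<and> sets \<mu> = sets borel \<and> invariant_measure Q \<mu>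
        \<longrightarrow> emeasure \<mu> (Rec Q) = 1)"
proof (intro conjI impI allI)
  note cpt = assms(1) and Q = assms(4)
  show "Rec_u Q \<subseteq> Rec Q"
    unfolding Rec_u_def Rec_def 
    by (intro Collect_mono all_mono imp_mono impI[OF liminf_pos_imp_ex_pos]) simp_all
  show "Rec_wu Q \<subseteq> Rec_w Q"
    unfolding Rec_wu_def Rec_w_def
    by (intro Collect_mono all_mono imp_mono) (use liminf_pos_imp_ex_pos in fast)+
  show "Rec_u Q \<subseteq> Rec_wu Q"
    unfolding Rec_u_def Rec_wu_def by blast
  show "closure (Rec Q) \<subseteq> Rec_w Q"
    by (rule closure_Rec_subset_Rec_w)
  show "Rec_w Q \<noteq> {}"
    using cpt Q by (rule Rec_w_nonempty)
  show "emeasure \<mu> (Rec Q) = 1"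
    if "prob_space \<mu> \<and> sets \<mu> = sets borel \<and> invariant_measure Q \<mu>" for \<mu>
    using that invariant_measure_non_returning[OF Q, of \<mu>]
    by (intro emeasure_Rec_eq_1[OF cpt Q]) auto
  assume div: "\<forall>A\<in>sets borel. emeasure m A > 0 \<longrightarrow>
    (\<Sum>n. emeasure m (kernel_preimage Q (Suc n) A \<inter> A)) = \<infinity>"
  have null: "emeasure m D = 0" if D: "D \<in> sets borel" "non_returning Q D" for D
  proof (rule ccontr)
    assume "emeasure m D \<noteq> 0"
    then have "(\<Sum>n. emeasure m (kernel_preimage Q (Suc n) D \<inter> D)) = \<infinity>"
      using div D(1) by (simp add: zero_less_iff_neq_zero)
    then show False
      by (simp add: kernel_preimage_Int_non_returning[OF D(2)])
  qed
  show full: "emeasure m (Rec Q) = 1"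
    using cpt Q assms(2,3) null by (rule emeasure_Rec_eq_1)
  show "supp m \<subseteq> Rec_w Q"
    using assms(2,3) full by (rule supp_subset_Rec_w)
qed

end
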